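(* Let $A,B,C$ be finite-dimensional complex vector spaces and let $T\in A\otimes B\otimes C$. Suppose $T$ admits an expression $$T=\sum_{i=1}^r u_i\otimes v_i\otimes w_i$$ with nonzero vectors $u_i\in A$, $v_i\in B$, $w_i\in C$. Let $\mathcal S_A=\{[u_i]\}_{i=1}^r\subset\mathbb P A$, $\mathcal S_B=\{[v_i]\}_{i=1}^r\subset\mathbb P B$, $\mathcal S_C=\{[w_i]\}_{i=1}^r\subset\mathbb P C$, regarded as families of points indexed by $1,\dots,r$, and let $k_{\mathcal S_A},k_{\mathcal S_B},k_{\mathcal S_C}$ be their Kruskal ranks. If $$r\leq \tfrac12\left(k_{\mathcal S_A}+k_{\mathcal S_B}+k_{\mathcal S_C}\right)-1,$$ then $T$ has rank $r$ and its expression as a rank $r$ tensor is essentially unique; that is, whenever $T=\sum_{i=1}^r \tilde u_i\otimes\tilde v_i\otimes\tilde w_i$ with $\tilde u_i\in A$, $\tilde v_i\in B$, $\tilde w_i\in C$, there is a permutation $\pi$ of $\{1,\dots,r\}$ such that $\tilde u_i\otimes\tilde v_i\otimes\tilde w_i=u_{\pi(i)}\otimes v_{\pi(i)}\otimes w_{\pi(i)}$ for all $i$.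
   Context: The rank of a tensor $T\in A\otimes B\otimes C$ is the smallest $r$ such that $T$ can be written as a sum of $r$ tensors of the form $u\otimes v\otimes w$ with $u\in A$, $v\in B$, $w\in C$. For a nonzero vector $x$ in a vector space $W$, $[x]$ denotes the corresponding point of the projective space $\mathbb P W$. Let $\mathcal S=\{x_1,\dots,x_p\}$ be a finite indexed family of points of $\mathbb P W$ (repetitions allowed). The points are in $2$-general linear position if no two of them coincide, in $3$-general linear position if no three of them lie on a line, and in general in $k$-general linear position if no $k$ of them lie in a linear subspace $\mathbb P^{k-2}\subset \mathbb P W$. The Kruskal rank $k_{\mathcal S}$ is the maximum $k$ such that the points of $\mathcal S$ are in $k$-general linear position. Equivalently, choosing vectors representing the points, $k_{\mathcal S}$ is the largest integer $k\le p$ such that every subfamily of $k$ of these vectors (with distinct indices) is linearly independent. In particular $k_{\mathcal S}\leq p$. *)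

theory Defs
  imports Complex_Main "HOL-Library.Function_Algebras" "HOL-Combinatorics.Permutations"
begin

text \<open>
  Vector spaces are whole types with an explicit complex scalar multiplication \<open>s\<close>, as in
  \<^locale>\<open>finite_dimensional_vector_space\<close>. For finite-dimensional \<open>A\<close>, \<open>B\<close>, \<open>C\<close>, the tensor product
  \<open>A \<otimes> B \<otimes> C\<close> is the space of trilinear forms on \<open>A* \<times> B* \<times> C*\<close>, where \<open>u \<otimes> v \<otimes> w\<close> is
  the form \<open>(\<alpha>, \<beta>, \<gamma>) \<mapsto> \<alpha> u * \<beta> v * \<gamma> w\<close>. The forms are extended by 0 to arguments outside
  the dual spaces, so that tensors are equal iff they are equal as functions. Sums of tensors are
  taken pointwise.
\<close>

type_synonym ('a, 'b, 'c) tensor =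
  "('a \<Rightarrow> complex) \<Rightarrow> ('b \<Rightarrow> complex) \<Rightarrow> ('c \<Rightarrow> complex) \<Rightarrow> complex"

definition dual_space :: "(complex \<Rightarrow> 'a \<Rightarrow> 'a::ab_group_add) \<Rightarrow> ('a \<Rightarrow> complex) set" where
  "dual_space s = {\<alpha>. Vector_Spaces.linear s (*) \<alpha>}"

definition linear_form_on :: "('a \<Rightarrow> complex) set \<Rightarrow> (('a \<Rightarrow> complex) \<Rightarrow> complex) \<Rightarrow> bool" where
  "linear_form_on D F \<longleftrightarrow>
     (\<forall>\<alpha>\<in>D. \<forall>\<alpha>'\<in>D. F (\<lambda>x. \<alpha> x + \<alpha>' x) = F \<alpha> + F \<alpha>') \<and>
     (\<forall>c. \<forall>\<alpha>\<in>D. F (\<lambda>x. c * \<alpha> x) = c * F \<alpha>)"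

definition tensor_space ::
  "(complex \<Rightarrow> 'a \<Rightarrow> 'a::ab_group_add) \<Rightarrow> (complex \<Rightarrow> 'b \<Rightarrow> 'b::ab_group_add) \<Rightarrow>
   (complex \<Rightarrow> 'c \<Rightarrow> 'c::ab_group_add) \<Rightarrow> ('a, 'b, 'c) tensor set" where
  "tensor_space sA sB sC = {T.
     (\<forall>\<beta>\<in>dual_space sB. \<forall>\<gamma>\<in>dual_space sC. linear_form_on (dual_space sA) (\<lambda>\<alpha>. T \<alpha> \<beta> \<gamma>)) \<and>
     (\<forall>\<alpha>\<in>dual_space sA. \<forall>\<gamma>\<in>dual_space sC. linear_form_on (dual_space sB) (\<lambda>\<beta>. T \<alpha> \<beta> \<gamma>)) \<and>
     (\<forall>\<alpha>\<in>dual_space sA. \<forall>\<beta>\<in>dual_space sB. linear_form_on (dual_space sC) (\<lambda>\<gamma>. T \<alpha> \<beta> \<gamma>)) \<and>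
     (\<forall>\<alpha> \<beta> \<gamma>. \<not> (\<alpha> \<in> dual_space sA \<and> \<beta> \<in> dual_space sB \<and> \<gamma> \<in> dual_space sC) \<longrightarrow>
        T \<alpha> \<beta> \<gamma> = 0)}"

definition elem_tensor ::
  "(complex \<Rightarrow> 'a \<Rightarrow> 'a::ab_group_add) \<Rightarrow> (complex \<Rightarrow> 'b \<Rightarrow> 'b::ab_group_add) \<Rightarrow>
   (complex \<Rightarrow> 'c \<Rightarrow> 'c::ab_group_add) \<Rightarrow> 'a \<Rightarrow> 'b \<Rightarrow> 'c \<Rightarrow> ('a, 'b, 'c) tensor" where
  "elem_tensor sA sB sC u v w = (\<lambda>\<alpha> \<beta> \<gamma>.
     if \<alpha> \<in> dual_space sA \<and> \<beta> \<in> dual_space sB \<and> \<gamma> \<in> dual_space sC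
     then \<alpha> u * \<beta> v * \<gamma> w else 0)"

definition tensor_rank ::
  "(complex \<Rightarrow> 'a \<Rightarrow> 'a::ab_group_add) \<Rightarrow> (complex \<Rightarrow> 'b \<Rightarrow> 'b::ab_group_add) \<Rightarrow>
   (complex \<Rightarrow> 'c \<Rightarrow> 'c::ab_group_add) \<Rightarrow> ('a, 'b, 'c) tensor \<Rightarrow> nat" where
  "tensor_rank sA sB sC T =
     (LEAST r. \<exists>u v w. T = (\<Sum>i=1..r. elem_tensor sA sB sC (u i) (v i) (w i)))"

lemma elem_tensor_in_tensor_space: "elem_tensor sA sB sC u v w \<in> tensor_space sA sB sC"
proof -
  have [simp]: "(\<lambda>x. f x + g x) \<in> dual_space s" if "f \<in> dual_space s" "g \<in> dual_space s"
    for f g and s :: "complex \<Rightarrow> 'z \<Rightarrow> 'z::ab_group_add"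
    using that by (auto simp: dual_space_def Vector_Spaces.linear_iff algebra_simps)
  have [simp]: "(\<lambda>x. c * f x) \<in> dual_space s" if "f \<in> dual_space s"
    for c f and s :: "complex \<Rightarrow> 'z \<Rightarrow> 'z::ab_group_add"
    using that by (auto simp: dual_space_def Vector_Spaces.linear_iff algebra_simps)
  show ?thesis
    by (auto simp: tensor_space_def elem_tensor_def linear_form_on_def algebra_simps)
qed

text \<open>A point of the projective space is a one-dimensional linear subspace.\<close>

definition proj_point :: "(complex \<Rightarrow> 'a \<Rightarrow> 'a::ab_group_add) \<Rightarrow> 'a \<Rightarrow> 'a set" where
  "proj_point s x = module.span s {x}"

text \<open>
  A projective subspace of dimension at most \<open>k - 2\<close> is a linear subspace of dimension less than
  \<open>k\<close>. Requiring dimension exactly \<open>k - 1\<close> instead would make the condition vacuous when \<open>k - 1\<close>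
  exceeds the dimension of the ambient space.
\<close>

definition general_linear_position ::
  "(complex \<Rightarrow> 'a \<Rightarrow> 'a::ab_group_add) \<Rightarrow> nat \<Rightarrow> 'i set \<Rightarrow> ('i \<Rightarrow> 'a set) \<Rightarrow> bool" where
  "general_linear_position s k I P \<longleftrightarrow>
     \<not> (\<exists>J L. J \<subseteq> I \<and> finite J \<and> card J = k \<and>
          module.subspace s L \<and> vector_space.dim s L < k \<and> (\<forall>j\<in>J. P j \<subseteq> L))"

definition kruskal_rank ::
  "(complex \<Rightarrow> 'a \<Rightarrow> 'a::ab_group_add) \<Rightarrow> 'i set \<Rightarrow> ('i \<Rightarrow> 'a set) \<Rightarrow> nat" where
  "kruskal_rank s I P = Max {k. k \<le> card I \<and> general_linear_position s k I P}"

lemma general_linear_position_iff_independent: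
  assumes "finite_dimensional_vector_space s B"
  shows "general_linear_position s k I (\<lambda>i. proj_point s (x i)) \<longleftrightarrow>
    (\<forall>J. J \<subseteq> I \<and> finite J \<and> card J = k \<longrightarrow> inj_on x J \<and> \<not> module.dependent s (x ` J))"
proof -
  interpret finite_dimensional_vector_space s B by fact
  have point: "proj_point s y \<subseteq> L \<longleftrightarrow> y \<in> L" if "subspace L" for y L
    using that by (metis proj_point_def empty_subsetI insert_subset span_base singletonI span_minimal subset_eq)
  have indep: "inj_on x J \<and> independent (x ` J) \<longleftrightarrow> card J \<le> dim (x ` J)" if "finite J" for J
  proof
    assume "inj_on x J \<and> independent (x ` J)"
    then show "card J \<le> dim (x ` J)"
      by (simp add: dim_eq_card_independent card_image)
  next
    assume *: "card J \<le> dim (x ` J)"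
    have "dim (x ` J) \<le> card (x ` J)" "card (x ` J) \<le> card J"
      using that dim_le_card[OF span_superset] card_image_le by auto
    with * have eq: "card (x ` J) = card J" "card (x ` J) = dim (x ` J)" by auto
    then show "inj_on x J \<and> independent (x ` J)"
      using that card_eq_dim[of "x ` J" "x ` J"] by (auto simp: eq_card_imp_inj_on span_superset)
  qed
  have "(\<exists>L. subspace L \<and> dim L < k \<and> (\<forall>j\<in>J. proj_point s (x j) \<subseteq> L)) \<longleftrightarrow>
      dim (x ` J) < k" (is "?l \<longleftrightarrow> ?r") for J
  proof
    assume ?l
    then obtain L where "subspace L" "dim L < k" "x ` J \<subseteq> L" using point by blast
    then show ?r using dim_subset[of "x ` J" L] by linarith
  next
    assume ?r
    then show ?l
      using point by (intro exI[of _ "span (x ` J)"]) (auto intro: span_base)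
  qed
  then show ?thesis
    unfolding general_linear_position_def using indep by (metis not_less)
qed

end

theory Submission
  imports Defs
begin

text \<open>
  The proof studies linear relations among product tensors, following an idea of Lovitz and Petrov.

  Two decompositions of the same tensor together form a family of product tensors with a linear
  relation. Call a family connected if its span is not the direct sum of the spans of two
  complementary nonempty parts. The heart of the matter is that connected families of product tensors
  have large span: if \<open>f a \<otimes> g a\<close> is a connected family then
  \<open>rank f + rank g \<le> rank (f \<otimes> g) + 1\<close> (lemma \<open>connected_tensor_rank\<close>). One builds the family up from
  a single index. If \<open>F\<close> is the part reached so far, connectedness supplies a minimal further set \<open>G\<close>
  with a relation into the span of \<open>F\<close>, and the rank of the tensors then grows by at least
  \<open>card G - 1\<close>. Contracting this relation with functionals on one of the factors shows that the ranks
  of the two factors together grow by at most \<open>card G - 1\<close> (lemma \<open>rank_gain_bound\<close>), so the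
  inequality is preserved.

  For triple products the bound is applied twice, once to \<open>f \<otimes> g\<close> and once to \<open>(f \<otimes> g) \<otimes> h\<close>. A
  connected family of \<open>N\<close> triple products with a nontrivial relation has rank at most \<open>N - 1\<close>, hence
  its three factors have total rank at most \<open>N + 1\<close> (lemma \<open>connected_triple_rank\<close>).

  Now compare a decomposition \<open>I\<close> that satisfies Kruskal's inequality with another one, \<open>J\<close>, that
  has at most as many terms. A minimal set of indices on which the partial sums agree, and which
  contains no more indices of \<open>J\<close> than of \<open>I\<close>, is connected. If it contained \<open>s \<ge> 2\<close> indices of \<open>I\<close>,
  its factors would have total rank at most \<open>2 * s + 1\<close>, whereas Kruskal's inequality makes that rank
  at least \<open>2 * s + 2\<close>. So it consists of one term from each side, and these two are equal (lemma
  \<open>spread_out_match\<close>). Removing them and repeating matches the two decompositions term by term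
  (theorem \<open>spread_out_unique\<close>). Allowing \<open>J\<close> to be shorter than \<open>I\<close> yields the rank together with
  uniqueness.
\<close>

section \<open>Ranks of indexed families of vectors\<close>

text \<open>
  Vectors may repeat in the families below, so rank and independence are attached to sets of
  indices rather than to sets of vectors.
\<close>

locale vector_families = vector_space
begin

definition family_rank :: "('i \<Rightarrow> 'b) \<Rightarrow> 'i set \<Rightarrow> nat" where
  "family_rank f S = dim (f ` S)"

text \<open>
  The vectors of \<open>P\<close> stay distinct and independent in the quotient by the span of \<open>F\<close>. In matroid
  language \<open>P\<close> is independent in the contraction by \<open>F\<close>.
\<close>

definition independent_over :: "('i \<Rightarrow> 'b) \<Rightarrow> 'i set \<Rightarrow> 'i set \<Rightarrow> bool" where
  "independent_over f F P \<longleftrightarrow>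
     (\<forall>c. (\<Sum>i\<in>P. c i *s f i) \<in> span (f ` F) \<longrightarrow> (\<forall>i\<in>P. c i = 0))"

text \<open>
  This is connectedness of the linear matroid of the family: the span of \<open>E\<close> is never the direct
  sum of the spans of two complementary nonempty parts. The coefficients \<open>c\<close> witness a nonzero
  common vector of the spans of \<open>F\<close> and of \<open>E - F\<close>.
\<close>

definition connected_family :: "('i \<Rightarrow> 'b) \<Rightarrow> 'i set \<Rightarrow> bool" where
  "connected_family f E \<longleftrightarrow>
     (\<forall>F. F \<subseteq> E \<and> F \<noteq> {} \<and> F \<noteq> E \<longrightarrow>
        (\<exists>c. (\<Sum>a\<in>E. c a *s f a) = 0 \<and> (\<Sum>a\<in>F. c a *s f a) \<noteq> 0))"

lemma dim_insert_finite:
  assumes "finite S"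
  shows "dim (insert x S) = (if x \<in> span S then dim S else Suc (dim S))"
proof (cases "x \<in> span S")
  case True
  then show ?thesis by (metis dim_span span_redundant)
next
  case False
  obtain B where B: "B \<subseteq> S" "independent B" "S \<subseteq> span B" "card B = dim S"
    using basis_exists by blast
  have sp: "span B = span S"
    using B by (meson span_eq span_superset subset_trans)
  have "finite B" using B assms finite_subset by blast
  have "x \<notin> span B" using False sp by simp
  then have "x \<notin> B" using span_base by blast
  have "independent (insert x B)"
    using \<open>x \<notin> span B\<close> B independent_insertI by blast
  moreover have "span (insert x B) = span (insert x S)"
    by (simp add: span_insert sp)
  ultimately have "dim (insert x S) = card (insert x B)"
    by (metis dim_eq_card)
  then show ?thesis
    using False B \<open>x \<notin> B\<close> \<open>finite B\<close> by simp
qed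

lemma in_span_image_Un:
  assumes "finite P"
  shows "x \<in> span (f ` (F \<union> P)) \<longleftrightarrow> (\<exists>c. x - (\<Sum>i\<in>P. c i *s f i) \<in> span (f ` F))"
  using assms
proof (induction P arbitrary: x)
  case (insert b P)
  have "x \<in> span (f ` (F \<union> insert b P)) \<longleftrightarrow> (\<exists>k. x - k *s f b \<in> span (f ` (F \<union> P)))"
    by (simp add: span_breakdown_eq)
  also have "\<dots> \<longleftrightarrow> (\<exists>k c. x - k *s f b - (\<Sum>i\<in>P. c i *s f i) \<in> span (f ` F))"
    using insert by simp
  also have "\<dots> \<longleftrightarrow> (\<exists>c. x - (\<Sum>i\<in>insert b P. c i *s f i) \<in> span (f ` F))"
  proof safe
    fix k c assume *: "x - k *s f b - (\<Sum>i\<in>P. c i *s f i) \<in> span (f ` F)"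
    have "(\<Sum>i\<in>P. (c(b := k)) i *s f i) = (\<Sum>i\<in>P. c i *s f i)"
      using insert by (intro sum.cong) auto
    with * insert have "x - (\<Sum>i\<in>insert b P. (c(b := k)) i *s f i) \<in> span (f ` F)"
      by (simp add: diff_diff_eq)
    then show "\<exists>c. x - (\<Sum>i\<in>insert b P. c i *s f i) \<in> span (f ` F)" by blast
  next
    fix c assume "x - (\<Sum>i\<in>insert b P. c i *s f i) \<in> span (f ` F)"
    with insert have "x - c b *s f b - (\<Sum>i\<in>P. c i *s f i) \<in> span (f ` F)"
      by (simp add: diff_diff_eq)
    then show "\<exists>k c. x - k *s f b - (\<Sum>i\<in>P. c i *s f i) \<in> span (f ` F)" by blast
  qed
  finally show ?case .
qed simp

lemma in_span_image_finite:
  assumes "finite P"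
  shows "x \<in> span (f ` P) \<longleftrightarrow> (\<exists>c. x = (\<Sum>i\<in>P. c i *s f i))"
  using in_span_image_Un[OF assms, of x f "{}"] by simp

lemma span_combination: "finite F \<Longrightarrow> (\<Sum>a\<in>F. c a *s f a) \<in> span (f ` F)"
  by (intro span_sum span_scale span_base) auto

lemma independent_over_insert:
  assumes "finite P" "b \<notin> P"
  shows "independent_over f F (insert b P) \<longleftrightarrow>
    independent_over f F P \<and> f b \<notin> span (f ` (F \<union> P))"
proof (intro iffI conjI notI)
  assume ind: "independent_over f F (insert b P)"
  show "independent_over f F P"
    unfolding independent_over_def
  proof (intro allI impI)
    fix c assume *: "(\<Sum>i\<in>P. c i *s f i) \<in> span (f ` F)"
    have "(\<Sum>i\<in>insert b P. (c(b := 0)) i *s f i) = (\<Sum>i\<in>P. c i *s f i)"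
      using assms by (auto intro!: sum.cong)
    then have "\<forall>i\<in>insert b P. (c(b := 0)) i = 0"
      using * ind unfolding independent_over_def by metis
    then show "\<forall>i\<in>P. c i = 0" using assms by (auto split: if_splits)
  qed
  assume "f b \<in> span (f ` (F \<union> P))"
  then obtain c where c: "f b - (\<Sum>i\<in>P. c i *s f i) \<in> span (f ` F)"
    using in_span_image_Un assms by blast
  have "(\<Sum>i\<in>P. ((\<lambda>i. - c i)(b := 1)) i *s f i) = - (\<Sum>i\<in>P. c i *s f i)"
    unfolding sum_negf[symmetric] using assms by (intro sum.cong) auto
  then have "(\<Sum>i\<in>insert b P. ((\<lambda>i. - c i)(b := 1)) i *s f i) = f b - (\<Sum>i\<in>P. c i *s f i)"
    using assms by simp
  then have "\<forall>i\<in>insert b P. ((\<lambda>i. - c i)(b := 1)) i = 0"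
    using c ind unfolding independent_over_def by metis
  then show False by simp
next
  assume ind: "independent_over f F P \<and> f b \<notin> span (f ` (F \<union> P))"
  show "independent_over f F (insert b P)"
    unfolding independent_over_def
  proof (intro allI impI)
    fix c assume *: "(\<Sum>i\<in>insert b P. c i *s f i) \<in> span (f ` F)"
    have "c b = 0"
    proof (rule ccontr)
      assume nz: "c b \<noteq> 0"
      have "(1 / c b) *s (\<Sum>i\<in>insert b P. c i *s f i) \<in> span (f ` F)"
        using * by (rule span_scale)
      moreover have "(1 / c b) *s (\<Sum>i\<in>insert b P. c i *s f i)
          = f b - (\<Sum>i\<in>P. (- (c i / c b)) *s f i)"
        using assms nz by (simp add: scale_right_distrib scale_sum_right sum_negf)
      ultimately have "f b \<in> span (f ` (F \<union> P))"
        using in_span_image_Un[OF assms(1), of "f b" f F] by (metis (no_types))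
      with ind show False by blast
    qed
    with * assms have "(\<Sum>i\<in>P. c i *s f i) \<in> span (f ` F)" by simp
    with ind \<open>c b = 0\<close> show "\<forall>i\<in>insert b P. c i = 0"
      unfolding independent_over_def by blast
  qed
qed

lemma family_rank_empty [simp]: "family_rank f {} = 0"
  by (simp add: family_rank_def dim_eq_card[of "{}"] independent_empty)

lemma family_rank_insert:
  assumes "finite S"
  shows "family_rank f (insert b S) =
    (if f b \<in> span (f ` S) then family_rank f S else Suc (family_rank f S))"
  using assms by (simp add: family_rank_def dim_insert_finite)

lemma family_rank_Un_le:
  assumes "finite F" "finite P"
  shows "family_rank f (F \<union> P) \<le> family_rank f F + card P"
  using assms(2,1) by (induction P) (auto simp: family_rank_insert)

lemma family_rank_mono:
  assumes "finite T" "S \<subseteq> T"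
  shows "family_rank f S \<le> family_rank f T"
proof -
  have "family_rank f S \<le> family_rank f (S \<union> P)" if "finite P" for P
    using that finite_subset[OF assms(2,1)]
    by (induction P) (auto simp: family_rank_insert)
  from this[of T] show ?thesis using assms by (simp add: Un_absorb1)
qed

lemma family_rank_Un_eq_iff:
  assumes "finite F" "finite P"
  shows "family_rank f (F \<union> P) = family_rank f F + card P \<longleftrightarrow> independent_over f F P"
  using assms(2)
proof (induction P)
  case empty
  then show ?case by (simp add: independent_over_def)
next
  case (insert b P)
  then show ?case
    using family_rank_Un_le[OF assms(1) insert(1), of f] assms
    by (auto simp: independent_over_insert family_rank_insert)
qed

lemma family_rank_eq_card_iff:
  assumes "finite P"
  shows "family_rank f P = card P \<longleftrightarrow> independent_over f {} P"
  using family_rank_Un_eq_iff[OF finite.emptyI assms, of f]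
  by simp

lemma family_rank_le_card: "finite P \<Longrightarrow> family_rank f P \<le> card P"
  using dim_le_card[of "f ` P" "f ` P"] card_image_le[of P f] span_superset
  by (fastforce simp: family_rank_def)

lemma relative_basis:
  assumes "finite F" "finite G"
  obtains P where "P \<subseteq> G" "independent_over f F P" "f ` G \<subseteq> span (f ` (F \<union> P))"
  using assms(2)
proof (induction G arbitrary: thesis)
  case empty
  then show ?case by (auto simp: independent_over_def)
next
  case (insert b G)
  then obtain P where P: "P \<subseteq> G" "independent_over f F P" "f ` G \<subseteq> span (f ` (F \<union> P))"
    by metis
  show ?case
  proof (cases "f b \<in> span (f ` (F \<union> P))")
    case True
    with P show ?thesis using insert.prems(1)[of P] by blast
  next
    case False
    have fin: "finite P" "b \<notin> P" using P insert finite_subset by blast+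
    have "span (f ` (F \<union> P)) \<subseteq> span (f ` (F \<union> insert b P))"
      by (intro span_mono) auto
    moreover have "f b \<in> span (f ` (F \<union> insert b P))" by (intro span_base) auto
    ultimately show ?thesis using P False fin
      by (intro insert.prems(1)[of "insert b P"]) (auto simp: independent_over_insert)
  qed
qed

text \<open>
  This provides the step by which a subset \<open>F\<close> of a connected family grows. Take \<open>G\<close> outside \<open>F\<close> of
  least size such that some combination over \<open>G\<close> is a nonzero vector in the span of \<open>F\<close>. Minimality
  forces all coefficients of that combination to be nonzero, and makes \<open>G\<close> without any one of its
  indices independent over \<open>F\<close>. So adding \<open>G\<close> raises the rank by \<open>card G - 1\<close>; this is an ear of
  the matroid.
\<close>

lemma minimal_linked_set:
  assumes fin: "finite E" and "F \<subseteq> E"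
    and "(\<Sum>a\<in>E. c a *s h a) = 0" "(\<Sum>a\<in>F. c a *s h a) \<noteq> 0"
  obtains G d where "G \<subseteq> E - F" "G \<noteq> {}" "\<And>b. b \<in> G \<Longrightarrow> d b \<noteq> 0"
    "(\<Sum>a\<in>F \<union> G. d a *s h a) = 0" "(\<Sum>a\<in>G. d a *s h a) \<noteq> 0"
    "family_rank h F + card G \<le> family_rank h (F \<union> G) + 1"
proof -
  have finF: "finite F" using assms finite_subset by blast
  define linked where "linked G \<longleftrightarrow> G \<subseteq> E - F \<and>
    (\<exists>d. (\<Sum>a\<in>G. d a *s h a) \<in> span (h ` F) \<and> (\<Sum>a\<in>G. d a *s h a) \<noteq> 0)" for G
  have "(\<Sum>a\<in>E. c a *s h a) = (\<Sum>a\<in>E-F. c a *s h a) + (\<Sum>a\<in>F. c a *s h a)"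
    using sum.subset_diff[OF assms(2) fin] .
  then have "(\<Sum>a\<in>E-F. c a *s h a) = - (\<Sum>a\<in>F. c a *s h a)"
    using assms by (simp add: eq_neg_iff_add_eq_0)
  then have "linked (E - F)"
    unfolding linked_def using assms finF span_neg[OF span_combination[OF finF]]
    by (intro conjI exI[of _ c]) auto
  then obtain G where G: "linked G" and least: "\<And>G'. linked G' \<Longrightarrow> card G \<le> card G'"
    using ex_has_least_nat[of linked "E - F" card] by blast
  obtain d where GE: "G \<subseteq> E - F" and d: "(\<Sum>a\<in>G. d a *s h a) \<in> span (h ` F)"
      "(\<Sum>a\<in>G. d a *s h a) \<noteq> 0"
    using G unfolding linked_def by blast
  have finG: "finite G" using GE fin finite_subset by blast
  have not_linked: "\<not> linked (G - {b})" if "b \<in> G" for b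
    using least[of "G - {b}"] card_Diff1_less[OF finG that] by linarith
  have drop: "(\<Sum>a\<in>G. e a *s h a) = (\<Sum>a\<in>G - {b}. e a *s h a)" if "b \<in> G" "e b = 0" for b e
    using that finG by (simp add: sum.remove)
  have G': "G - {b} \<subseteq> E - F" for b using GE by blast
  have nz: "d b \<noteq> 0" if "b \<in> G" for b
    using not_linked[OF that] drop[OF that, of d] d G' unfolding linked_def by metis
  obtain b0 where b0: "b0 \<in> G" using d by fastforce
  have "independent_over h F (G - {b0})"
    unfolding independent_over_def
  proof (intro allI impI ballI)
    fix e b assume e: "(\<Sum>i\<in>G - {b0}. e i *s h i) \<in> span (h ` F)" and b: "b \<in> G - {b0}"
    show "e b = 0"
    proof (rule ccontr)
      assume eb: "e b \<noteq> 0"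
      have e0: "(\<Sum>i\<in>G - {b0}. e i *s h i) = 0"
        using not_linked[OF b0] e G' unfolding linked_def by blast
      \<comment> \<open>A vanishing combination \<open>e\<close> can be subtracted so as to cancel the coefficient of \<open>b\<close> without
        changing the sum, which contradicts the minimality of \<open>G\<close>.\<close>
      define k where "k = d b / e b"
      define e' where "e' a = d a - k * (e(b0 := 0)) a" for a
      have "(\<Sum>a\<in>G. (e(b0 := 0)) a *s h a) = (\<Sum>i\<in>G - {b0}. e i *s h i)"
        using drop[OF b0, of "e(b0 := 0)"] by (simp cong: sum.cong_simp)
      then have "(\<Sum>a\<in>G. e' a *s h a) = (\<Sum>a\<in>G. d a *s h a)"
        using e0 unfolding e'_def
        by (simp add: scale_left_diff_distrib sum_subtractf scale_scale[symmetric]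
            scale_sum_right[symmetric] del: scale_scale fun_upd_apply)
      moreover have "e' b = 0" using b eb by (simp add: e'_def k_def)
      ultimately have "linked (G - {b})"
        unfolding linked_def using d G' drop[of b e'] b by (metis DiffD1)
      then show False using not_linked b by blast
    qed
  qed
  then have "family_rank h (F \<union> (G - {b0})) = family_rank h F + card (G - {b0})"
    using family_rank_Un_eq_iff finF finG by blast
  moreover have "family_rank h (F \<union> (G - {b0})) \<le> family_rank h (F \<union> G)"
    using finF finG by (intro family_rank_mono) auto
  moreover have "card G = card (G - {b0}) + 1" using b0 finG card.remove by fastforce
  ultimately have rank: "family_rank h F + card G \<le> family_rank h (F \<union> G) + 1" by simp
  obtain e where e: "(\<Sum>a\<in>G. d a *s h a) = (\<Sum>a\<in>F. e a *s h a)"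
    using d in_span_image_finite[OF finF] by blast
  \<comment> \<open>On \<open>F\<close> the sign is reversed so that the two equal combinations add up to a relation.\<close>
  define d' where "d' a = (if a \<in> G then d a else - e a)" for a
  have sG: "(\<Sum>a\<in>G. d' a *s h a) = (\<Sum>a\<in>G. d a *s h a)"
    by (simp add: d'_def)
  have "(\<Sum>a\<in>F. d' a *s h a) = (\<Sum>a\<in>F. - (e a *s h a))"
    using GE by (intro sum.cong) (auto simp: d'_def)
  then have "(\<Sum>a\<in>F \<union> G. d' a *s h a) = 0"
    using finF finG GE sG e by (subst sum.union_disjoint) (auto simp: sum_negf)
  then show thesis
    using that[of G d'] GE b0 nz sG d rank by (auto simp: d'_def)
qed

end

section \<open>Ranks of connected families of product tensors\<close>

text \<open>
  A vector is represented by its values on a set of functionals, so vectors live in a space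
  \<open>'s \<Rightarrow> 'k\<close> of functions and the tensor product of two of them is the pointwise product on pairs.
  All families of vectors and of tensors are then families in spaces of the same kind.
\<close>

interpretation funs: vector_families "\<lambda>(c::'k::field) (x::'s \<Rightarrow> 'k) s. c * x s"
  by unfold_locales (auto simp: fun_eq_iff algebra_simps)

lemma sum_fun_apply: "(\<Sum>i\<in>A. f i) x = (\<Sum>i\<in>A. f i x)"
  by (induction A rule: infinite_finite_induct) auto

definition tensor_family ::
  "('i \<Rightarrow> 's \<Rightarrow> 'k::field) \<Rightarrow> ('i \<Rightarrow> 't \<Rightarrow> 'k) \<Rightarrow> 'i \<Rightarrow> 's \<times> 't \<Rightarrow> 'k" where
  "tensor_family f g a = (\<lambda>(s, t). f a s * g a t)"

text \<open>
  Fix a coordinate \<open>t\<close> of the second factor. The relation becomes a relation among the vectors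
  \<open>f a\<close>, and modulo the span of \<open>F\<close> every \<open>f b\<close> is the combination of the basis \<open>P\<close> with
  coefficients \<open>A b i\<close>. Independence of \<open>P\<close> modulo that span makes the coefficient of each basis
  vector vanish. In invariant terms, the relation is contracted with the functional that is dual to
  \<open>f i\<close> and kills \<open>F\<close>.
\<close>

lemma contraction_coefficients:
  fixes f :: "'i \<Rightarrow> 's \<Rightarrow> 'k::field" and g :: "'i \<Rightarrow> 't \<Rightarrow> 'k"
  assumes fin: "finite F" "finite G" "finite P" and disj: "F \<inter> G = {}"
    and ind: "funs.independent_over f F P"
    and rel: "\<And>s t. (\<Sum>a\<in>F \<union> G. c a * f a s * g a t) = 0"
    and A: "\<And>b. b \<in> G \<Longrightarrow> f b - (\<Sum>i\<in>P. (\<lambda>s. A b i * f i s)) \<in> funs.span (f ` F)"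
    and "i \<in> P"
  shows "(\<Sum>b\<in>G. c b * A b i * g b t) = 0"
proof -
  define D where "D i = (\<Sum>b\<in>G. c b * A b i * g b t)" for i
  let ?V = "funs.span (f ` F)"
  have "(\<Sum>b\<in>G. (\<lambda>s. (c b * g b t) * (f b - (\<Sum>i\<in>P. (\<lambda>s. A b i * f i s))) s)) \<in> ?V"
    by (intro funs.span_sum funs.span_scale A)
  moreover have "(\<Sum>a\<in>F. (\<lambda>s. (c a * g a t) * f a s)) \<in> ?V"
    by (intro funs.span_combination fin)
  ultimately have "- (\<Sum>a\<in>F. (\<lambda>s. (c a * g a t) * f a s))
      - (\<Sum>b\<in>G. (\<lambda>s. (c b * g b t) * (f b - (\<Sum>i\<in>P. (\<lambda>s. A b i * f i s))) s)) \<in> ?V"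
    by (intro funs.span_diff funs.span_neg)
  also have "- (\<Sum>a\<in>F. (\<lambda>s. (c a * g a t) * f a s))
      - (\<Sum>b\<in>G. (\<lambda>s. (c b * g b t) * (f b - (\<Sum>i\<in>P. (\<lambda>s. A b i * f i s))) s))
      = (\<Sum>i\<in>P. (\<lambda>s. D i * f i s))"
  proof
    fix s
    have "(\<Sum>b\<in>G. (c b * g b t) * (\<Sum>i\<in>P. A b i * f i s)) = (\<Sum>i\<in>P. D i * f i s)"
      unfolding D_def sum_distrib_left sum_distrib_right
      by (subst sum.swap) (simp add: mult_ac)
    moreover have "- (\<Sum>a\<in>F. c a * g a t * f a s) = (\<Sum>b\<in>G. c b * g b t * f b s)"
      using rel[of s t] sum.union_disjoint[OF fin(1,2) disj, of "\<lambda>a. c a * f a s * g a t"]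
      by (intro minus_unique) (simp add: mult_ac)
    ultimately show "(- (\<Sum>a\<in>F. (\<lambda>s. (c a * g a t) * f a s))
      - (\<Sum>b\<in>G. (\<lambda>s. (c b * g b t) * (f b - (\<Sum>i\<in>P. (\<lambda>s. A b i * f i s))) s))) s
      = (\<Sum>i\<in>P. (\<lambda>s. D i * f i s)) s"
      by (simp add: sum_fun_apply right_diff_distrib sum_subtractf)
  qed
  finally have "\<forall>i\<in>P. D i = 0" using ind unfolding funs.independent_over_def by blast
  then show ?thesis using \<open>i \<in> P\<close> by (simp add: D_def)
qed

text \<open>
  In the contraction with the functional dual to \<open>f i\<close>, the only index of \<open>P\<close> that survives is \<open>i\<close>
  itself. As \<open>c i\<close> is nonzero, this expresses \<open>g i\<close> through the remaining vectors of \<open>G\<close>.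
\<close>

lemma contraction_in_span:
  fixes f :: "'i \<Rightarrow> 's \<Rightarrow> 'k::field" and g :: "'i \<Rightarrow> 't \<Rightarrow> 'k"
  assumes fin: "finite F" "finite G" and disj: "F \<inter> G = {}"
    and P: "P \<subseteq> G" "funs.independent_over f F P" "f ` G \<subseteq> funs.span (f ` (F \<union> P))"
    and rel: "\<And>s t. (\<Sum>a\<in>F \<union> G. c a * f a s * g a t) = 0"
    and nz: "\<And>b. b \<in> G \<Longrightarrow> c b \<noteq> 0"
  shows "g ` P \<subseteq> funs.span (g ` (G - P))"
proof clarify
  fix i assume i: "i \<in> P"
  have finP: "finite P" using P fin finite_subset by blast
  have "\<forall>b\<in>G. \<exists>e. f b - (\<Sum>i\<in>P. (\<lambda>s. e i * f i s)) \<in> funs.span (f ` F)"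
    using P(3) funs.in_span_image_Un[OF finP, of _ f F] by blast
  then obtain e where e: "\<And>b. b \<in> G \<Longrightarrow> f b - (\<Sum>i\<in>P. (\<lambda>s. e b i * f i s)) \<in> funs.span (f ` F)"
    by metis
  \<comment> \<open>A vector of the basis is its own expansion, whatever expansion was chosen above.\<close>
  define A where "A b = (if b \<in> P then (\<lambda>i. if i = b then 1 else 0) else e b)" for b
  have A: "f b - (\<Sum>i\<in>P. (\<lambda>s. A b i * f i s)) \<in> funs.span (f ` F)" if "b \<in> G" for b
  proof (cases "b \<in> P")
    case True
    then have "(\<Sum>i\<in>P. (\<lambda>s. A b i * f i s)) = f b"
      using finP by (auto simp: fun_eq_iff sum_fun_apply A_def if_distrib[of "\<lambda>x. x * _"] cong: if_cong)
    then show ?thesis by (simp add: funs.span_zero)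
  qed (use e that in \<open>simp add: A_def\<close>)
  have ci: "c i \<noteq> 0" using nz i P by blast
  have combination: "g i = (\<Sum>b\<in>G - P. (\<lambda>t. (- (c b * A b i) / c i) * g b t))"
  proof
    fix t
    have "0 = (\<Sum>b\<in>G. c b * A b i * g b t)"
      using contraction_coefficients[OF fin finP disj P(2) rel A i, where t = t] by simp
    also have "\<dots> = (\<Sum>b\<in>G - P. c b * A b i * g b t) + (\<Sum>b\<in>P. c b * A b i * g b t)"
      by (rule sum.subset_diff[OF P(1) fin(2)])
    also have "(\<Sum>b\<in>P. c b * A b i * g b t) = c i * g i t"
      using i finP by (simp add: A_def if_distrib[of "\<lambda>x. _ * x"] if_distrib[of "\<lambda>x. x * _"] cong: if_cong)
    finally have "c i * g i t = - (\<Sum>b\<in>G - P. c b * A b i * g b t)"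
      by (intro minus_unique[symmetric]) simp
    then have "g i t = - (\<Sum>b\<in>G - P. c b * A b i * g b t) / c i"
      using ci by (metis nonzero_mult_div_cancel_left)
    then show "g i t = (\<Sum>b\<in>G - P. (\<lambda>t. (- (c b * A b i) / c i) * g b t)) t"
      by (simp add: sum_fun_apply sum_negf sum_divide_distrib)
  qed
  show "g i \<in> funs.span (g ` (G - P))"
    by (rule ssubst[OF combination]) (intro funs.span_combination finite_Diff fin)
qed

text \<open>
  Let \<open>p\<close> and \<open>q\<close> be the rank gains of \<open>f\<close> and \<open>g\<close> when \<open>G\<close> is added to \<open>F\<close>; the claim is
  \<open>p + q \<le> card G - 1\<close>. A basis \<open>P\<close> of \<open>f\<close> over \<open>F\<close> has \<open>p\<close> elements, and on \<open>P\<close> the vectors of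
  \<open>g\<close> lie in the span of the rest \<open>Q\<close> of \<open>G\<close>, so \<open>q \<le> card Q\<close>. If equality held, \<open>Q\<close> would be a
  basis of \<open>g\<close> over \<open>F\<close>, and with the roles exchanged \<open>f\<close> on \<open>G\<close> would lie in the span of \<open>f\<close> on
  \<open>P\<close>, with no contribution from \<open>F\<close>. Then the part of the relation over \<open>G\<close> could be contracted
  to zero coefficient by coefficient, whereas it is assumed to be nonzero.
\<close>

lemma rank_gain_bound:
  fixes f :: "'i \<Rightarrow> 's \<Rightarrow> 'k::field" and g :: "'i \<Rightarrow> 't \<Rightarrow> 'k"
  assumes fin: "finite F" "finite G" and disj: "F \<inter> G = {}"
    and rel: "\<And>s t. (\<Sum>a\<in>F \<union> G. c a * f a s * g a t) = 0"
    and nz: "\<And>b. b \<in> G \<Longrightarrow> c b \<noteq> 0"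
    and part: "(\<Sum>b\<in>G. c b * f b s0 * g b t0) \<noteq> 0"
  shows "funs.family_rank f (F \<union> G) + funs.family_rank g (F \<union> G) + 1
    \<le> funs.family_rank f F + funs.family_rank g F + card G"
proof -
  obtain P where P: "P \<subseteq> G" "funs.independent_over f F P" "f ` G \<subseteq> funs.span (f ` (F \<union> P))"
    using funs.relative_basis[OF fin] by blast
  define Q where "Q = G - P"
  have finPQ: "finite P" "finite Q" using P fin finite_subset by (auto simp: Q_def)
  have card: "card G = card P + card Q"
    using P fin by (simp add: Q_def card_Diff_subset card_mono finPQ)
  have gP: "g ` P \<subseteq> funs.span (g ` Q)"
    unfolding Q_def using contraction_in_span[OF fin disj P rel nz] .
  have "funs.span (g ` Q) \<subseteq> funs.span (g ` (F \<union> Q))" by (intro funs.span_mono) auto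
  moreover have "g ` (F \<union> Q) \<subseteq> funs.span (g ` (F \<union> Q))" by (rule funs.span_superset)
  moreover have "F \<union> G = F \<union> Q \<union> P" using P by (auto simp: Q_def)
  ultimately have gG: "g ` (F \<union> G) \<subseteq> funs.span (g ` (F \<union> Q))" using gP by auto
  have fG: "f ` (F \<union> G) \<subseteq> funs.span (f ` (F \<union> P))"
    using P(3) funs.span_superset[of "f ` (F \<union> P)"] by auto
  have rank_eq: "funs.family_rank h (F \<union> G) = funs.family_rank h (F \<union> S)"
    if "h ` (F \<union> G) \<subseteq> funs.span (h ` (F \<union> S))" "S \<subseteq> G" for h :: "'i \<Rightarrow> 'x \<Rightarrow> 'k" and S
  proof -
    have "h ` (F \<union> S) \<subseteq> h ` (F \<union> G)" using that by auto
    then have "funs.span (h ` (F \<union> S)) = funs.span (h ` (F \<union> G))"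
      using that(1) by (intro antisym funs.span_mono funs.span_minimal) auto
    then show ?thesis unfolding funs.family_rank_def by (metis funs.dim_span)
  qed
  have f_rank: "funs.family_rank f (F \<union> G) = funs.family_rank f F + card P"
    using rank_eq[OF fG P(1)] funs.family_rank_Un_eq_iff[OF fin(1) finPQ(1)] P(2) by metis
  have g_rank: "funs.family_rank g (F \<union> G) = funs.family_rank g (F \<union> Q)"
    by (rule rank_eq[OF gG]) (auto simp: Q_def)
  have "funs.family_rank g (F \<union> Q) \<noteq> funs.family_rank g F + card Q"
  proof
    assume "funs.family_rank g (F \<union> Q) = funs.family_rank g F + card Q"
    then have indQ: "funs.independent_over g F Q"
      using funs.family_rank_Un_eq_iff fin finPQ by blast
    have "f ` Q \<subseteq> funs.span (f ` (G - Q))"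
      using gG rel nz
      by (intro contraction_in_span[OF fin disj _ indQ, where c = c and g = f])
        (auto simp: Q_def mult_ac)
    moreover have "G - Q = P" "G = P \<union> Q" using P by (auto simp: Q_def)
    ultimately have "f ` G \<subseteq> funs.span (f ` P)"
      using funs.span_superset[of "f ` P"] by auto
    then have "\<forall>b\<in>G. \<exists>e. f b = (\<Sum>i\<in>P. (\<lambda>s. e i * f i s))"
      using funs.in_span_image_finite[OF finPQ(1), of _ f] by blast
    then obtain A where A: "\<And>b. b \<in> G \<Longrightarrow> f b = (\<Sum>i\<in>P. (\<lambda>s. A b i * f i s))"
      by metis
    have zero: "(\<Sum>b\<in>G. c b * A b i * g b t) = 0" if "i \<in> P" for i t
    proof (rule contraction_coefficients[OF fin finPQ(1) disj P(2) rel _ that])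
      fix b assume "b \<in> G"
      from A[OF this] show "f b - (\<Sum>i\<in>P. (\<lambda>s. A b i * f i s)) \<in> funs.span (f ` F)"
        by (metis diff_self funs.span_zero)
    qed
    have "(\<Sum>b\<in>G. c b * f b s0 * g b t0) = (\<Sum>b\<in>G. c b * (\<Sum>i\<in>P. A b i * f i s0) * g b t0)"
      using fun_cong[OF A, of _ s0] by (intro sum.cong refl) (simp add: sum_fun_apply)
    also have "\<dots> = (\<Sum>i\<in>P. f i s0 * (\<Sum>b\<in>G. c b * A b i * g b t0))"
      unfolding sum_distrib_left sum_distrib_right
      by (subst sum.swap) (simp add: mult_ac)
    finally show False using part zero by simp
  qed
  with funs.family_rank_Un_le[OF fin(1) finPQ(2), of g]
  have "funs.family_rank g (F \<union> G) + 1 \<le> funs.family_rank g F + card Q"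
    using g_rank by linarith
  with f_rank card show ?thesis by linarith
qed

text \<open>
  Singletons satisfy the inequality. If a nonempty subset satisfies it and is not everything, a
  minimal linked set \<open>G\<close> enlarges it: the rank of the tensors grows by at least \<open>card G - 1\<close>, and the
  ranks of the two factors together by at most that much. Hence a maximal subset that satisfies the
  inequality is all of \<open>E\<close>.
\<close>

lemma connected_tensor_rank:
  fixes f :: "'i \<Rightarrow> 's \<Rightarrow> 'k::field" and g :: "'i \<Rightarrow> 't \<Rightarrow> 'k"
  assumes fin: "finite E" and conn: "funs.connected_family (tensor_family f g) E"
  shows "funs.family_rank f E + funs.family_rank g E
    \<le> funs.family_rank (tensor_family f g) E + 1"
proof (cases "E = {}")
  case True
  then show ?thesis by simp
next
  case False
  let ?h = "tensor_family f g"
  define good where "good F \<longleftrightarrow> F \<subseteq> E \<and> F \<noteq> {} \<and>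
    funs.family_rank f F + funs.family_rank g F \<le> funs.family_rank ?h F + 1" for F
  obtain a where "a \<in> E" using False by blast
  have single: "funs.family_rank x {b} = (if x b = 0 then 0 else 1)" for x :: "'i \<Rightarrow> 'x \<Rightarrow> 'k" and b
    using funs.family_rank_insert[of "{}" x b]
    by (simp add: funs.span_empty)
  have "?h a \<noteq> 0" if "f a \<noteq> 0" "g a \<noteq> 0"
    using that by (auto simp: tensor_family_def fun_eq_iff)
  then have "good {a}" using \<open>a \<in> E\<close> by (auto simp: good_def single)
  moreover have bounded: "finite {F. good F}"
    using fin by (intro finite_subset[of "{F. good F}" "Pow E"]) (auto simp: good_def)
  ultimately obtain F where F: "good F" and max: "\<And>F'. good F' \<Longrightarrow> F \<subseteq> F' \<Longrightarrow> F' = F"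
    using finite_has_maximal[of "{F. good F}"] by auto
  have finF: "finite F" using F fin finite_subset by (auto simp: good_def)
  have "F = E"
  proof (rule ccontr)
    assume "F \<noteq> E"
    then obtain c where c: "(\<Sum>a\<in>E. (\<lambda>s. c a * ?h a s)) = 0" "(\<Sum>a\<in>F. (\<lambda>s. c a * ?h a s)) \<noteq> 0"
      using conn F unfolding funs.connected_family_def good_def by blast
    have "F \<subseteq> E" using F by (simp add: good_def)
    obtain G d where G: "G \<subseteq> E - F" "G \<noteq> {}" and d: "\<And>b. b \<in> G \<Longrightarrow> d b \<noteq> 0"
      "(\<Sum>a\<in>F \<union> G. (\<lambda>s. d a * ?h a s)) = 0" "(\<Sum>a\<in>G. (\<lambda>s. d a * ?h a s)) \<noteq> 0"
      "funs.family_rank ?h F + card G \<le> funs.family_rank ?h (F \<union> G) + 1"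
      by (rule funs.minimal_linked_set[OF fin \<open>F \<subseteq> E\<close> c])
        (rule that, assumption, assumption, blast, assumption+)
    have finG: "finite G" using G fin finite_subset by blast
    have "(\<Sum>a\<in>F \<union> G. d a * f a s * g a t) = 0" for s t
      using fun_cong[OF d(2), of "(s, t)"] by (simp add: sum_fun_apply tensor_family_def mult_ac)
    moreover obtain s0 t0 where "(\<Sum>a\<in>G. d a * f a s0 * g a t0) \<noteq> 0"
      using d(3) by (auto simp: fun_eq_iff sum_fun_apply tensor_family_def mult_ac)
    moreover have "F \<inter> G = {}" using G by blast
    ultimately have "funs.family_rank f (F \<union> G) + funs.family_rank g (F \<union> G) + 1
        \<le> funs.family_rank f F + funs.family_rank g F + card G"
      using rank_gain_bound[OF finF finG, of d f g] d(1) by blast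
    with d(4) F G have "good (F \<union> G)" by (auto simp: good_def)
    from max[OF this] G show False by blast
  qed
  with F show ?thesis by (simp add: good_def)
qed

text \<open>
  If the span of the \<open>f a\<close> were a direct sum over two parts of \<open>E\<close>, the span of the tensors
  would be one too. A coordinate \<open>t\<close> of the second factor at which the partial sum is nonzero turns
  a witness \<open>c\<close> for the tensors into the witness \<open>c a * g a t\<close> for \<open>f\<close>.
\<close>

lemma connected_tensor_left:
  fixes f :: "'i \<Rightarrow> 's \<Rightarrow> 'k::field" and g :: "'i \<Rightarrow> 't \<Rightarrow> 'k"
  assumes "funs.connected_family (tensor_family f g) E"
  shows "funs.connected_family f E"
  unfolding funs.connected_family_def
proof (intro allI impI)
  fix F assume "F \<subseteq> E \<and> F \<noteq> {} \<and> F \<noteq> E"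
  then obtain c where c: "(\<Sum>a\<in>E. (\<lambda>x. c a * tensor_family f g a x)) = 0"
      "(\<Sum>a\<in>F. (\<lambda>x. c a * tensor_family f g a x)) \<noteq> 0"
    using assms unfolding funs.connected_family_def by blast
  from c(2) obtain s t where st: "(\<Sum>a\<in>F. c a * (f a s * g a t)) \<noteq> 0"
    by (auto simp: fun_eq_iff sum_fun_apply tensor_family_def)
  have "(\<Sum>a\<in>E. c a * (f a s' * g a t)) = 0" for s'
    using fun_cong[OF c(1), of "(s', t)"] by (simp add: sum_fun_apply tensor_family_def)
  with st show "\<exists>c. (\<Sum>a\<in>E. (\<lambda>x. c a * f a x)) = 0 \<and> (\<Sum>a\<in>F. (\<lambda>x. c a * f a x)) \<noteq> 0"
    by (intro exI[of _ "\<lambda>a. c a * g a t"]) (auto simp: fun_eq_iff sum_fun_apply mult_ac)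
qed

text \<open>
  The two-factor bound is used for \<open>f\<close> and \<open>g\<close>, and again for \<open>tensor_family f g\<close> and \<open>h\<close>. The
  nontrivial relation makes the rank of the triple products at most \<open>card E - 1\<close>.
\<close>

lemma connected_triple_rank:
  fixes f :: "'i \<Rightarrow> 's \<Rightarrow> 'k::field" and g :: "'i \<Rightarrow> 't \<Rightarrow> 'k" and h :: "'i \<Rightarrow> 'w \<Rightarrow> 'k"
  defines "z \<equiv> tensor_family (tensor_family f g) h"
  assumes fin: "finite E" and conn: "funs.connected_family z E"
    and rel: "(\<Sum>a\<in>E. (\<lambda>x. c a * z a x)) = 0" and "a \<in> E" "c a \<noteq> 0"
  shows "funs.family_rank f E + funs.family_rank g E + funs.family_rank h E \<le> card E + 1"
proof -
  have "\<not> funs.independent_over z {} E"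
  proof
    assume "funs.independent_over z {} E"
    moreover have "(\<Sum>a\<in>E. (\<lambda>x. c a * z a x)) \<in> funs.span (z ` {})"
      unfolding rel by (rule funs.span_zero)
    ultimately have "c a = 0"
      using \<open>a \<in> E\<close> unfolding funs.independent_over_def by blast
    with \<open>c a \<noteq> 0\<close> show False by contradiction
  qed
  then have "funs.family_rank z E < card E"
    using funs.family_rank_eq_card_iff[OF fin, of z] funs.family_rank_le_card[OF fin, of z]
    by linarith
  moreover have "funs.family_rank (tensor_family f g) E + funs.family_rank h E
      \<le> funs.family_rank z E + 1"
    using connected_tensor_rank[OF fin] conn unfolding z_def by blast
  moreover have "funs.family_rank f E + funs.family_rank g E
      \<le> funs.family_rank (tensor_family f g) E + 1"
    using connected_tensor_rank[OF fin] connected_tensor_left conn unfolding z_def by blast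
  ultimately show ?thesis by linarith
qed

section \<open>Matching two decompositions of a tensor\<close>

text \<open>
  This is the form in which Kruskal's inequality enters the matching argument. Unlike the inequality
  itself, it passes to subsets of \<open>I\<close> by definition, which permits induction on \<open>I\<close>.
\<close>

definition spread_out ::
  "('i \<Rightarrow> 's \<Rightarrow> 'k::field) \<Rightarrow> ('i \<Rightarrow> 't \<Rightarrow> 'k) \<Rightarrow> ('i \<Rightarrow> 'w \<Rightarrow> 'k) \<Rightarrow> 'i set \<Rightarrow> bool" where
  "spread_out f g h I \<longleftrightarrow> (\<forall>S\<subseteq>I. 2 \<le> card S \<longrightarrow>
     2 * card S + 2 \<le> funs.family_rank f S + funs.family_rank g S + funs.family_rank h S)"

text \<open>
  Among the nonempty sets \<open>X\<close> of indices on which the two sides agree and which contain at least as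
  many indices from \<open>I\<close> as from \<open>J\<close>, choose a minimal one. No proper nonempty subset of it has
  agreeing sides: otherwise its complement in \<open>X\<close> would agree too, and one of the two would respect
  the count. So \<open>X\<close> is connected, and the rank bound gives a total rank of at most \<open>card X + 1\<close>,
  which is at most \<open>2 * card (X \<inter> I) + 1\<close>. As \<open>I\<close> is spread out, \<open>X\<close> has only one index in \<open>I\<close>; it
  has at most one in \<open>J\<close> by the count, and at least one because the tensor at the index in \<open>I\<close> is
  nonzero.
\<close>

lemma spread_out_match:
  fixes f :: "'i \<Rightarrow> 's \<Rightarrow> 'k::field" and g :: "'i \<Rightarrow> 't \<Rightarrow> 'k" and h :: "'i \<Rightarrow> 'w \<Rightarrow> 'k"
  defines "z \<equiv> tensor_family (tensor_family f g) h"
  assumes fin: "finite I" "finite J" and disj: "I \<inter> J = {}" and le: "card J \<le> card I"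
    and eq: "(\<Sum>i\<in>I. z i) = (\<Sum>j\<in>J. z j)" and nz: "\<And>i. i \<in> I \<Longrightarrow> z i \<noteq> 0"
    and spread: "spread_out f g h I" and "I \<noteq> {}"
  shows "\<exists>i\<in>I. \<exists>j\<in>J. z i = z j"
proof -
  \<comment> \<open>With these signs, agreement of the two sides on a set is the vanishing of one signed sum.\<close>
  define \<epsilon> where "\<epsilon> a = (if a \<in> I then 1 else - 1 :: 'k)" for a
  define D where "D X = (\<Sum>a\<in>X. (\<lambda>x. \<epsilon> a * z a x))" for X
  define balanced where "balanced X \<longleftrightarrow>
    X \<subseteq> I \<union> J \<and> X \<noteq> {} \<and> card (X \<inter> J) \<le> card (X \<inter> I) \<and> D X = 0" for X
  have finX: "finite X" if "X \<subseteq> I \<union> J" for X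
    using that fin finite_subset by blast
  have D: "D X = (\<Sum>i\<in>X \<inter> I. z i) - (\<Sum>j\<in>X \<inter> J. z j)" if "X \<subseteq> I \<union> J" for X
  proof -
    have "D ((X \<inter> I) \<union> (X \<inter> J)) = D (X \<inter> I) + D (X \<inter> J)"
      unfolding D_def using finX[OF that] disj by (intro sum.union_disjoint) auto
    moreover have "(X \<inter> I) \<union> (X \<inter> J) = X" using that by blast
    moreover have "D (X \<inter> I) = (\<Sum>i\<in>X \<inter> I. z i)"
      unfolding D_def by (intro sum.cong) (auto simp: \<epsilon>_def)
    moreover have "D (X \<inter> J) = (\<Sum>j\<in>X \<inter> J. - z j)"
      unfolding D_def using disj by (intro sum.cong) (auto simp: \<epsilon>_def fun_eq_iff)
    ultimately show ?thesis by (simp only: sum_negf add_uminus_conv_diff)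
  qed
  have "(I \<union> J) \<inter> I = I" "(I \<union> J) \<inter> J = J" by auto
  then have "balanced (I \<union> J)"
    using D[of "I \<union> J"] eq le \<open>I \<noteq> {}\<close> by (simp add: balanced_def)
  moreover have "finite {X. balanced X}"
    using fin by (intro finite_subset[of "{X. balanced X}" "Pow (I \<union> J)"]) (auto simp: balanced_def)
  ultimately obtain X where X: "balanced X" and min: "\<And>Y. balanced Y \<Longrightarrow> Y \<subseteq> X \<Longrightarrow> Y = X"
    using finite_has_minimal[of "{X. balanced X}"] by auto
  have XIJ: "X \<subseteq> I \<union> J" and DX: "D X = 0" and cX: "card (X \<inter> J) \<le> card (X \<inter> I)" and "X \<noteq> {}"
    using X by (auto simp: balanced_def)
  have conn: "funs.connected_family z X"
    unfolding funs.connected_family_def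
  proof (intro allI impI exI[of _ \<epsilon>] conjI notI)
    show "(\<Sum>a\<in>X. (\<lambda>s. \<epsilon> a * z a s)) = 0" using DX by (simp add: D_def)
    fix F assume F: "F \<subseteq> X \<and> F \<noteq> {} \<and> F \<noteq> X" and "(\<Sum>a\<in>F. (\<lambda>s. \<epsilon> a * z a s)) = 0"
    then have DF: "D F = 0" by (simp add: D_def)
    have "D X = D (X - F) + D F"
      unfolding D_def using F finX[OF XIJ] by (intro sum.subset_diff) auto
    then have DF': "D (X - F) = 0" using DX DF by simp
    have split: "card (X \<inter> K) = card (F \<inter> K) + card ((X - F) \<inter> K)" for K
    proof -
      have "X \<inter> K = (F \<inter> K) \<union> ((X - F) \<inter> K)" using F by blast
      moreover have "card ((F \<inter> K) \<union> ((X - F) \<inter> K)) = card (F \<inter> K) + card ((X - F) \<inter> K)"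
        using finX[OF XIJ] F by (intro card_Un_disjoint) (auto dest: finite_subset)
      ultimately show ?thesis by simp
    qed
    have "card (F \<inter> J) \<le> card (F \<inter> I) \<or> card ((X - F) \<inter> J) \<le> card ((X - F) \<inter> I)"
      using cX split[of I] split[of J] by linarith
    then have "balanced F \<or> balanced (X - F)"
      using F XIJ DF DF' by (auto simp: balanced_def)
    then show False using min[of F] min[of "X - F"] F by blast
  qed
  have "card ((X \<inter> I) \<union> (X \<inter> J)) = card (X \<inter> I) + card (X \<inter> J)"
    using finX[OF XIJ] disj by (intro card_Un_disjoint) auto
  moreover have "(X \<inter> I) \<union> (X \<inter> J) = X" using XIJ by blast
  ultimately have cardX: "card X = card (X \<inter> I) + card (X \<inter> J)" by simp
  obtain a where "a \<in> X" using \<open>X \<noteq> {}\<close> by blast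
  have "\<epsilon> a \<noteq> 0" by (simp add: \<epsilon>_def)
  have "funs.family_rank f X + funs.family_rank g X + funs.family_rank h X \<le> card X + 1"
    using connected_triple_rank[OF finX[OF XIJ] conn[unfolded z_def], of \<epsilon> a]
      DX \<open>a \<in> X\<close> \<open>\<epsilon> a \<noteq> 0\<close> by (simp add: D_def z_def)
  moreover have "funs.family_rank x (X \<inter> I) \<le> funs.family_rank x X" for x :: "'i \<Rightarrow> 'x \<Rightarrow> 'k"
    using finX[OF XIJ] by (intro funs.family_rank_mono) auto
  from this[of f] this[of g] this[of h]
  have "2 \<le> card (X \<inter> I) \<Longrightarrow> 2 * card (X \<inter> I) + 2
      \<le> funs.family_rank f X + funs.family_rank g X + funs.family_rank h X"
    using spread[unfolded spread_out_def, rule_format, of "X \<inter> I"] by fastforce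
  ultimately have "card (X \<inter> I) \<le> 1" using cardX cX by fastforce
  moreover have "card (X \<inter> I) \<noteq> 0"
    using cardX cX \<open>X \<noteq> {}\<close> finX[OF XIJ] by auto
  ultimately have "card (X \<inter> I) = 1" by simp
  then obtain i where i: "X \<inter> I = {i}" by (rule card_1_singletonE)
  have "i \<in> I" using i by blast
  have "X \<inter> J \<noteq> {}"
    using D[OF XIJ] DX i nz[OF \<open>i \<in> I\<close>] by auto
  moreover have "card (X \<inter> J) \<le> 1" using cX i by simp
  ultimately have "card (X \<inter> J) = 1"
    using finX[OF XIJ] card_gt_0_iff[of "X \<inter> J"] by auto
  then obtain j where j: "X \<inter> J = {j}" by (rule card_1_singletonE)
  have "z i = z j" using D[OF XIJ] DX i j by simp
  then show ?thesis using i j by blast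
qed

text \<open>
  Cancelling a matched pair leaves a smaller instance of the same problem. The second decomposition
  may be shorter, and its tensors may vanish, so this also gives minimality of the first one.
\<close>

theorem spread_out_unique:
  fixes f :: "'i \<Rightarrow> 's \<Rightarrow> 'k::field" and g :: "'i \<Rightarrow> 't \<Rightarrow> 'k" and h :: "'i \<Rightarrow> 'w \<Rightarrow> 'k"
  defines "z \<equiv> tensor_family (tensor_family f g) h"
  assumes fin: "finite I" "finite J" and disj: "I \<inter> J = {}" and le: "card J \<le> card I"
    and eq: "(\<Sum>i\<in>I. z i) = (\<Sum>j\<in>J. z j)" and nz: "\<And>i. i \<in> I \<Longrightarrow> z i \<noteq> 0"
    and spread: "spread_out f g h I"
  shows "\<exists>\<sigma>. bij_betw \<sigma> J I \<and> (\<forall>j\<in>J. z j = z (\<sigma> j))"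
  using fin disj le eq nz spread
proof (induction "card I" arbitrary: I J)
  case 0
  then show ?case by (auto simp: bij_betw_def)
next
  case (Suc n)
  then have "I \<noteq> {}" by auto
  then obtain i j where ij: "i \<in> I" "j \<in> J" "z i = z j"
    using spread_out_match[OF Suc.prems(1-4) _ _ Suc.prems(7)] Suc.prems(5,6)
    unfolding z_def by blast
  have "\<exists>\<sigma>. bij_betw \<sigma> (J - {j}) (I - {i}) \<and> (\<forall>j\<in>J - {j}. z j = z (\<sigma> j))"
  proof (rule Suc.hyps(1))
    show "n = card (I - {i})" "card (J - {j}) \<le> card (I - {i})"
      using Suc.prems Suc.hyps(2) ij by simp_all
    show "(\<Sum>i\<in>I - {i}. z i) = (\<Sum>j\<in>J - {j}. z j)"
      using Suc.prems ij by (simp add: sum.remove)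
    show "spread_out f g h (I - {i})"
      using Suc.prems(7) unfolding spread_out_def by blast
  qed (use Suc.prems in auto)
  then obtain \<sigma> where \<sigma>: "bij_betw \<sigma> (J - {j}) (I - {i})" "\<And>a. a \<in> J - {j} \<Longrightarrow> z a = z (\<sigma> a)"
    by blast
  have "bij_betw (\<sigma>(j := i)) (J - {j}) (I - {i})"
    using \<sigma>(1) by (rule bij_betw_cong[THEN iffD1, rotated]) auto
  then have "bij_betw (\<sigma>(j := i)) ((J - {j}) \<union> {j}) ((I - {i}) \<union> {(\<sigma>(j := i)) j})"
    by (intro notIn_Un_bij_betw) auto
  moreover have "(J - {j}) \<union> {j} = J" "(I - {i}) \<union> {(\<sigma>(j := i)) j} = I" using ij by auto
  ultimately show ?case using \<sigma>(2) ij by (intro exI[of _ "\<sigma>(j := i)"]) auto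
qed

section \<open>Kruskal ranks and evaluation on the dual space\<close>

definition evaluation ::
  "(complex \<Rightarrow> 'a \<Rightarrow> 'a::ab_group_add) \<Rightarrow> 'a \<Rightarrow> ('a \<Rightarrow> complex) \<Rightarrow> complex" where
  "evaluation s x \<alpha> = (if \<alpha> \<in> dual_space s then \<alpha> x else 0)"

text \<open>
  The dual space separates points: there is a functional that is 1 at one vector of an independent
  family and 0 at the others, and evaluating there isolates its coefficient.
\<close>

lemma independent_over_evaluation:
  assumes "vector_space s" and fin: "finite P" and inj: "inj_on x P"
    and ind: "\<not> module.dependent s (x ` P)"
  shows "funs.independent_over (\<lambda>i. evaluation s (x i)) {} P"
  unfolding funs.independent_over_def
proof (intro allI impI ballI)
  interpret vector_space s by fact
  interpret pair: vector_space_pair s "(*) :: complex \<Rightarrow> complex \<Rightarrow> complex"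
    by unfold_locales (auto simp: algebra_simps)
  fix c i assume zero: "(\<Sum>j\<in>P. (\<lambda>\<alpha>. c j * evaluation s (x j) \<alpha>)) \<in> funs.span ((\<lambda>i. evaluation s (x i)) ` {})"
    and i: "i \<in> P"
  obtain \<alpha> where \<alpha>: "Vector_Spaces.linear s (*) \<alpha>"
      "\<forall>y\<in>x ` P. \<alpha> y = (if y = x i then 1 else 0)"
    using pair.linear_independent_extend[OF ind, of "\<lambda>y. if y = x i then 1 else 0"] by blast
  have "evaluation s (x j) \<alpha> = (if j = i then 1 else 0)" if "j \<in> P" for j
    using \<alpha> inj i that by (auto simp: evaluation_def dual_space_def inj_on_def)
  then have "(\<Sum>j\<in>P. c j * evaluation s (x j) \<alpha>) = (\<Sum>j\<in>P. if j = i then c j else 0)"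
    by (intro sum.cong) auto
  then have "(\<Sum>j\<in>P. c j * evaluation s (x j) \<alpha>) = c i" using fin i by simp
  moreover have "(\<Sum>j\<in>P. (\<lambda>\<alpha>. c j * evaluation s (x j) \<alpha>)) = 0"
    using zero by (simp add: funs.span_empty)
  then have "(\<Sum>j\<in>P. c j * evaluation s (x j) \<alpha>) = 0"
    using sum_fun_apply[of "\<lambda>j \<alpha>. c j * evaluation s (x j) \<alpha>" P \<alpha>] by simp
  ultimately show "c i = 0" by simp
qed

lemma evaluation_nonzero:
  assumes "vector_space s" "x \<noteq> 0"
  shows "evaluation s x \<noteq> 0"
proof
  interpret vector_space s by fact
  assume zero: "evaluation s x = 0"
  have "funs.independent_over (\<lambda>_::unit. evaluation s x) {} {()}"
    using assms by (intro independent_over_evaluation) (auto simp: independent_insert independent_empty span_empty)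
  then have "funs.family_rank (\<lambda>_::unit. evaluation s x) {()} = 1"
    using funs.family_rank_eq_card_iff[of "{()}" "\<lambda>_::unit. evaluation s x"] by simp
  with zero show False
    using funs.family_rank_insert[of "{}" "\<lambda>_::unit. evaluation s x" "()"] by (simp add: funs.span_zero)
qed

lemma kruskal_rank_properties:
  assumes "finite I"
  shows "kruskal_rank s I Q \<le> card I" "general_linear_position s (kruskal_rank s I Q) I Q"
proof -
  let ?K = "{k. k \<le> card I \<and> general_linear_position s k I Q}"
  have "0 \<in> ?K" by (auto simp: general_linear_position_def)
  moreover have "finite ?K" by simp
  ultimately have "Max ?K \<in> ?K" by (intro Max_in) auto
  then show "kruskal_rank s I Q \<le> card I" "general_linear_position s (kruskal_rank s I Q) I Q"
    by (auto simp: kruskal_rank_def)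
qed

text \<open>
  If \<open>S\<close> has at least as many indices as the Kruskal rank, it contains an independent subset of that
  size; if it has fewer, it is contained in one and is independent itself.
\<close>

lemma family_rank_ge_kruskal_rank:
  assumes fd: "finite_dimensional_vector_space s B" and fin: "finite I" and "S \<subseteq> I"
  shows "min (card S) (kruskal_rank s I (\<lambda>i. proj_point s (x i)))
    \<le> funs.family_rank (\<lambda>i. evaluation s (x i)) S"
proof -
  interpret finite_dimensional_vector_space s B by fact
  define k where "k = kruskal_rank s I (\<lambda>i. proj_point s (x i))"
  have finS: "finite S" using assms finite_subset by blast
  have "general_linear_position s k I (\<lambda>i. proj_point s (x i))"
    unfolding k_def by (rule kruskal_rank_properties(2)[OF fin])
  then have "\<forall>J. J \<subseteq> I \<and> finite J \<and> card J = k \<longrightarrow> inj_on x J \<and> independent (x ` J)"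
    by (simp only: general_linear_position_iff_independent[OF fd])
  then have indep: "inj_on x J \<and> independent (x ` J)" if "J \<subseteq> I" "card J = k" for J
    using that finite_subset[OF that(1) fin] by blast
  obtain J where J: "J \<subseteq> S" "card J = min (card S) k" "inj_on x J" "independent (x ` J)"
  proof (cases "k \<le> card S")
    case True
    then obtain J where "J \<subseteq> S" "card J = k" by (rule obtain_subset_with_card_n)
    then show thesis using that[of J] indep[of J] True \<open>S \<subseteq> I\<close> by simp
  next
    case False
    moreover have "k \<le> card I"
      unfolding k_def by (rule kruskal_rank_properties(1)[OF fin])
    ultimately have "\<exists>J. S \<subseteq> J \<and> J \<subseteq> I \<and> card J = k"
      using assms(3) fin by (intro exists_subset_between) auto
    then obtain J where J: "S \<subseteq> J" "J \<subseteq> I" "card J = k" by blast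
    have "inj_on x S" using indep[OF J(2,3)] J(1) inj_on_subset by blast
    moreover have "independent (x ` S)"
      by (rule independent_mono[OF conjunct2[OF indep[OF J(2,3)]] image_mono[OF J(1)]])
    ultimately show thesis using that[of S] False by simp
  qed
  have finJ: "finite J" using J finS finite_subset by blast
  have "funs.family_rank (\<lambda>i. evaluation s (x i)) J = card J"
    unfolding funs.family_rank_eq_card_iff[OF finJ]
    by (rule independent_over_evaluation[OF vector_space_axioms finJ J(3,4)])
  with funs.family_rank_mono[OF finS J(1), of "\<lambda>i. evaluation s (x i)"] J(2)
  show ?thesis unfolding k_def by simp
qed

text \<open>
  It remains to see that Kruskal's inequality makes the family spread out. A set of \<open>s\<close> indices has
  ranks at least \<open>min s k\<close> for the three Kruskal ranks \<open>k\<close>, so the sum of the three minima has to be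
  at least \<open>2 * s + 2\<close>. Since no Kruskal rank exceeds \<open>r\<close>, the inequality forces any two of them to
  have sum at least \<open>r + 2\<close>, hence each to be at least 2; the claim follows by distinguishing which of
  the three exceed \<open>s\<close>.
\<close>

lemma kruskal_matching:
  fixes sA :: "complex \<Rightarrow> 'a \<Rightarrow> 'a::ab_group_add"
    and sB :: "complex \<Rightarrow> 'b \<Rightarrow> 'b::ab_group_add"
    and sC :: "complex \<Rightarrow> 'c \<Rightarrow> 'c::ab_group_add"
    and r n :: nat
    and u u' :: "nat \<Rightarrow> 'a" and v v' :: "nat \<Rightarrow> 'b" and w w' :: "nat \<Rightarrow> 'c"
  defines "kA \<equiv> kruskal_rank sA {1..r} (\<lambda>i. proj_point sA (u i))"
    and "kB \<equiv> kruskal_rank sB {1..r} (\<lambda>i. proj_point sB (v i))"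
    and "kC \<equiv> kruskal_rank sC {1..r} (\<lambda>i. proj_point sC (w i))"
  assumes A: "finite_dimensional_vector_space sA BA"
    and B: "finite_dimensional_vector_space sB BB"
    and C: "finite_dimensional_vector_space sC BC"
    and nz: "\<forall>i\<in>{1..r}. u i \<noteq> 0 \<and> v i \<noteq> 0 \<and> w i \<noteq> 0"
    and bound: "2 * r + 2 \<le> kA + kB + kC"
    and "n \<le> r"
    and eq: "(\<Sum>i=1..r. elem_tensor sA sB sC (u i) (v i) (w i)) =
      (\<Sum>i=1..n. elem_tensor sA sB sC (u' i) (v' i) (w' i))"
  shows "\<exists>\<sigma>. bij_betw \<sigma> {1..n} {1..r} \<and>
    (\<forall>j\<in>{1..n}. elem_tensor sA sB sC (u' j) (v' j) (w' j) =
                  elem_tensor sA sB sC (u (\<sigma> j)) (v (\<sigma> j)) (w (\<sigma> j)))"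
proof -
  define f where "f = case_sum (\<lambda>i. evaluation sA (u i)) (\<lambda>j. evaluation sA (u' j))"
  define g where "g = case_sum (\<lambda>i. evaluation sB (v i)) (\<lambda>j. evaluation sB (v' j))"
  define h where "h = case_sum (\<lambda>i. evaluation sC (w i)) (\<lambda>j. evaluation sC (w' j))"
  define z where "z = tensor_family (tensor_family f g) h"
  \<comment> \<open>The two decompositions are indexed by the two sides of a disjoint sum.\<close>
  let ?I = "Inl ` {1..r} :: (nat + nat) set" and ?J = "Inr ` {1..n} :: (nat + nat) set"
  have zI: "z (Inl i) = (\<lambda>((\<alpha>, \<beta>), \<gamma>). elem_tensor sA sB sC (u i) (v i) (w i) \<alpha> \<beta> \<gamma>)" for i
    by (auto simp: z_def f_def g_def h_def tensor_family_def evaluation_def elem_tensor_def fun_eq_iff)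
  have zJ: "z (Inr j) = (\<lambda>((\<alpha>, \<beta>), \<gamma>). elem_tensor sA sB sC (u' j) (v' j) (w' j) \<alpha> \<beta> \<gamma>)" for j
    by (auto simp: z_def f_def g_def h_def tensor_family_def evaluation_def elem_tensor_def fun_eq_iff)
  have vs: "vector_space sA" "vector_space sB" "vector_space sC"
    using A B C by (simp_all add: finite_dimensional_vector_space_def)
  have "\<exists>\<sigma>. bij_betw \<sigma> ?J ?I \<and> (\<forall>j\<in>?J. z j = z (\<sigma> j))"
    unfolding z_def
  proof (rule spread_out_unique, fold z_def)
    show "finite ?I" "finite ?J" "?I \<inter> ?J = {}" "card ?J \<le> card ?I"
      using \<open>n \<le> r\<close> by (auto simp: card_image)
    show "(\<Sum>i\<in>?I. z i) = (\<Sum>j\<in>?J. z j)"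
    proof (rule ext)
      fix p :: "(('a \<Rightarrow> complex) \<times> ('b \<Rightarrow> complex)) \<times> ('c \<Rightarrow> complex)"
      obtain \<alpha> \<beta> \<gamma> where p: "p = ((\<alpha>, \<beta>), \<gamma>)" by (metis prod.exhaust)
      show "(\<Sum>i\<in>?I. z i) p = (\<Sum>j\<in>?J. z j) p"
        using fun_cong[OF fun_cong[OF fun_cong[OF eq, of \<alpha>], of \<beta>], of \<gamma>]
        by (simp add: p sum_fun_apply sum.reindex zI zJ)
    qed
    show "z a \<noteq> 0" if a: "a \<in> ?I" for a
    proof -
      obtain i where i: "a = Inl i" "i \<in> {1..r}" using a by blast
      obtain \<alpha> \<beta> \<gamma> where "evaluation sA (u i) \<alpha> \<noteq> 0" "evaluation sB (v i) \<beta> \<noteq> 0" "evaluation sC (w i) \<gamma> \<noteq> 0"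
        using evaluation_nonzero[OF vs(1), of "u i"] evaluation_nonzero[OF vs(2), of "v i"]
          evaluation_nonzero[OF vs(3), of "w i"] nz i by (auto simp: fun_eq_iff)
      then have "z a ((\<alpha>, \<beta>), \<gamma>) \<noteq> 0"
        by (simp add: i z_def f_def g_def h_def tensor_family_def)
      then show ?thesis by auto
    qed
    show "spread_out f g h ?I"
      unfolding spread_out_def
    proof (intro allI impI)
      fix S assume "S \<subseteq> ?I" and "2 \<le> card S"
      then obtain S' where S': "S = Inl ` S'" "S' \<subseteq> {1..r}" by (meson subset_imageE)
      have card: "card S = card S'" "card S' \<le> r"
        using S' card_mono[of "{1..r}" S'] by (auto simp: card_image)
      have "min (card S') kA \<le> funs.family_rank f S"
        "min (card S') kB \<le> funs.family_rank g S"
        "min (card S') kC \<le> funs.family_rank h S"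
        using family_rank_ge_kruskal_rank[OF A _ S'(2), of u] family_rank_ge_kruskal_rank[OF B _ S'(2), of v]
          family_rank_ge_kruskal_rank[OF C _ S'(2), of w]
        by (simp_all add: kA_def kB_def kC_def S' funs.family_rank_def image_image f_def g_def h_def)
      moreover have "kA \<le> r" "kB \<le> r" "kC \<le> r"
        using kruskal_rank_properties(1)[of "{1..r}"] by (auto simp: kA_def kB_def kC_def)
      ultimately show "2 * card S + 2 \<le> funs.family_rank f S + funs.family_rank g S + funs.family_rank h S"
        using bound card \<open>2 \<le> card S\<close> by (auto simp: min_def split: if_splits)
    qed
  qed
  then obtain \<sigma> where \<sigma>: "bij_betw \<sigma> ?J ?I" "\<forall>j\<in>?J. z j = z (\<sigma> j)" by blast
  define \<tau> where "\<tau> = projl \<circ> \<sigma> \<circ> Inr"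
  have projl: "bij_betw projl ?I {1..r}" by (intro bij_betw_byWitness[where f' = Inl]) auto
  have Inr: "bij_betw Inr {1..n} ?J" by (intro bij_betw_imageI) auto
  have "bij_betw \<tau> {1..n} {1..r}"
    unfolding \<tau>_def by (rule bij_betw_trans[OF Inr bij_betw_trans[OF \<sigma>(1) projl]])
  moreover have "elem_tensor sA sB sC (u' j) (v' j) (w' j) =
      elem_tensor sA sB sC (u (\<tau> j)) (v (\<tau> j)) (w (\<tau> j))" if j: "j \<in> {1..n}" for j
  proof -
    have "\<sigma> (Inr j) \<in> ?I" using \<sigma>(1) j by (auto simp: bij_betw_def)
    then have "\<sigma> (Inr j) = Inl (\<tau> j)" by (auto simp: \<tau>_def)
    then have "z (Inr j) = z (Inl (\<tau> j))" using \<sigma>(2) j by auto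
    then show ?thesis unfolding zI zJ by (auto simp: fun_eq_iff)
  qed
  ultimately show ?thesis by blast
qed

theorem theorem3:
  fixes sA :: "complex \<Rightarrow> 'a \<Rightarrow> 'a::ab_group_add"
    and sB :: "complex \<Rightarrow> 'b \<Rightarrow> 'b::ab_group_add"
    and sC :: "complex \<Rightarrow> 'c \<Rightarrow> 'c::ab_group_add"
    and BA :: "'a set" and BB :: "'b set" and BC :: "'c set"
    and T :: "('a, 'b, 'c) tensor"
    and r :: nat
    and u :: "nat \<Rightarrow> 'a" and v :: "nat \<Rightarrow> 'b" and w :: "nat \<Rightarrow> 'c"
  assumes "finite_dimensional_vector_space sA BA"
    and "finite_dimensional_vector_space sB BB"
    and "finite_dimensional_vector_space sC BC"
    and "T \<in> tensor_space sA sB sC"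
    and "T = (\<Sum>i=1..r. elem_tensor sA sB sC (u i) (v i) (w i))"
    and "\<forall>i\<in>{1..r}. u i \<noteq> 0 \<and> v i \<noteq> 0 \<and> w i \<noteq> 0"
    and "real r \<le> 1 / 2 * (real (kruskal_rank sA {1..r} (\<lambda>i. proj_point sA (u i)))
                       + real (kruskal_rank sB {1..r} (\<lambda>i. proj_point sB (v i)))
                       + real (kruskal_rank sC {1..r} (\<lambda>i. proj_point sC (w i)))) - 1"
  shows "tensor_rank sA sB sC T = r \<and>
    (\<forall>u' v' w'. T = (\<Sum>i=1..r. elem_tensor sA sB sC (u' i) (v' i) (w' i)) \<longrightarrow>
       (\<exists>\<pi>. \<pi> permutes {1..r} \<and>
          (\<forall>i\<in>{1..r}. elem_tensor sA sB sC (u' i) (v' i) (w' i) =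
                       elem_tensor sA sB sC (u (\<pi> i)) (v (\<pi> i)) (w (\<pi> i)))))"
proof (intro conjI allI impI)
  let ?t = "\<lambda>i. elem_tensor sA sB sC (u i) (v i) (w i)"
  have bound: "2 * r + 2 \<le> kruskal_rank sA {1..r} (\<lambda>i. proj_point sA (u i))
      + kruskal_rank sB {1..r} (\<lambda>i. proj_point sB (v i))
      + kruskal_rank sC {1..r} (\<lambda>i. proj_point sC (w i))"
  proof -
    have "real (2 * r + 2) \<le> real (kruskal_rank sA {1..r} (\<lambda>i. proj_point sA (u i))
      + kruskal_rank sB {1..r} (\<lambda>i. proj_point sB (v i))
      + kruskal_rank sC {1..r} (\<lambda>i. proj_point sC (w i)))"
      using assms(7) by (simp add: field_simps)
    then show ?thesis by (simp only: of_nat_le_iff)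
  qed
  note matching = kruskal_matching[OF assms(1-3,6) bound]
  show "tensor_rank sA sB sC T = r"
    unfolding tensor_rank_def
  proof (rule Least_equality)
    show "\<exists>u v w. T = (\<Sum>i=1..r. elem_tensor sA sB sC (u i) (v i) (w i))"
      using assms(5) by blast
    fix n :: nat assume "\<exists>u v w. T = (\<Sum>i=1..n. elem_tensor sA sB sC (u i) (v i) (w i))"
    then obtain u' v' w' where "(\<Sum>i=1..r. ?t i) = (\<Sum>i=1..n. elem_tensor sA sB sC (u' i) (v' i) (w' i))"
      using assms(5) by auto
    then have "\<exists>\<sigma>. bij_betw \<sigma> {1..n} {1..r}" if "n \<le> r"
      using matching[OF that] by blast
    then show "r \<le> n" using bij_betw_same_card by (metis card_atLeastAtMost diff_Suc_1 nat_le_linear)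
  qed
  fix u' v' w' assume "T = (\<Sum>i=1..r. elem_tensor sA sB sC (u' i) (v' i) (w' i))"
  then have "(\<Sum>i=1..r. ?t i) = (\<Sum>i=1..r. elem_tensor sA sB sC (u' i) (v' i) (w' i))"
    using assms(5) by simp
  from matching[OF order_refl this] obtain \<sigma> where \<sigma>: "bij_betw \<sigma> {1..r} {1..r}"
    "\<forall>i\<in>{1..r}. elem_tensor sA sB sC (u' i) (v' i) (w' i) = ?t (\<sigma> i)" by blast
  let ?\<pi> = "\<lambda>i. if i \<in> {1..r} then \<sigma> i else i"
  have "bij_betw ?\<pi> {1..r} {1..r}"
    using \<sigma>(1) by (rule bij_betw_cong[THEN iffD1, rotated]) auto
  then have "?\<pi> permutes {1..r}" by (rule bij_imp_permutes) auto
  with \<sigma>(2) show "\<exists>\<pi>. \<pi> permutes {1..r} \<and>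
      (\<forall>i\<in>{1..r}. elem_tensor sA sB sC (u' i) (v' i) (w' i) = ?t (\<pi> i))"
    by (intro exI[of _ ?\<pi>]) auto
qed

end
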